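(* Let $\lambda$ be a nonzero real number and $a,b\in\mathbb{R}$. For all integers $n\ge0$, \[ \beta_{n,\lambda}^{(a)}(x+y)=\sum_{k=0}^{n}\binom{n}{k}\Big[\beta_{k,\lambda}^{(a)}(x)+\frac{k}{2}\beta_{k-1,\lambda}^{(a-1)}(x)\Big]\mathcal{E}_{n-k,\lambda}(y), \] (where for $k=0$ the term $\frac{k}{2}\beta_{k-1,\lambda}^{(a-1)}(x)$ is interpreted as $0$), and \[ \mathcal{E}_{n,\lambda}^{(b)}(x+y)=\sum_{k=0}^{n}\binom{n}{k}\frac{2}{k+1}\,\beta_{n-k,\lambda}(x)\Big(\mathcal{E}_{k+1,\lambda}^{(b-1)}(y)-\mathcal{E}_{k+1,\lambda}^{(b)}(y)\Big). \]
   Context: For a nonzero real $\lambda$ and any $x$, set $(x)_{0,\lambda}=1$ and $(x)_{n,\lambda}=x(x-\lambda)\cdots(x-(n-1)\lambda)$ for $n\ge1$. The degenerate exponential is $e_{\lambda}^{x}(t)=\sum_{k\ge0}(x)_{k,\lambda}\frac{t^k}{k!}$ ($=(1+\lambda t)^{x/\lambda}$), $e_\lambda(t)=e_\lambda^1(t)$. For $\alpha\in\mathbb{R}$, $\beta_{n,\lambda}^{(\alpha)}(x)$ and $\mathcal{E}_{n,\lambda}^{(\alpha)}(x)$ are defined by $\left(\frac{t}{e_\lambda(t)-1}\right)^{\alpha}e_\lambda^x(t)=\sum_{n\ge0}\beta_{n,\lambda}^{(\alpha)}(x)\frac{t^n}{n!}$ and $\left(\frac{2}{e_\lambda(t)+1}\right)^{\alpha}e_\lambda^x(t)=\sum_{n\ge0}\mathcal{E}_{n,\lambda}^{(\alpha)}(x)\frac{t^n}{n!}$;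 also $\beta_{n,\lambda}(x)=\beta_{n,\lambda}^{(1)}(x)$ and $\mathcal{E}_{n,\lambda}(x)=\mathcal{E}_{n,\lambda}^{(1)}(x)$. *)

theory Defs
  imports Complex_Main "HOL-Computational_Algebra.Formal_Power_Series"
begin

definition degen_falling :: "real \<Rightarrow> 'a::real_field \<Rightarrow> nat \<Rightarrow> 'a" where
  "degen_falling l x n = (\<Prod>i<n. x - of_nat i * of_real l)"

definition degen_exp :: "real \<Rightarrow> 'a::real_field \<Rightarrow> 'a fps" where
  "degen_exp l x = Abs_fps (\<lambda>k. degen_falling l x k / fact k)"

(* Real power of a formal power series via the generalized binomial series:
   F^a = sum over j of (a gchoose j) * (F - 1)^j.
   The composition converges formally only if F has constant term 1, as it does
   for the two series to which it is applied below. *)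
definition fps_rpow :: "'a::real_field fps \<Rightarrow> real \<Rightarrow> 'a fps" where
  "fps_rpow F a = fps_binomial (of_real a) oo (F - 1)"

lemma fps_rpow_of_nat:
  fixes F :: "'a::real_field fps"
  assumes "fps_nth F 0 = 1"
  shows "fps_rpow F (real n) = F ^ n"
  using assms
  by (simp add: fps_rpow_def fps_binomial_of_nat fps_compose_power[symmetric] fps_compose_add_distrib)

lemma fps_rpow_add:
  fixes F :: "'a::real_field fps"
  assumes "fps_nth F 0 = 1"
  shows "fps_rpow F (a + b) = fps_rpow F a * fps_rpow F b"
  using assms
  by (simp add: fps_rpow_def fps_binomial_add_mult fps_compose_mult_distrib)

(* The numerator and denominator both have subdegree 1, so this is exact division
   of formal power series. *)
definition degen_bernoulli_base :: "real \<Rightarrow> 'a::real_field fps" where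
  "degen_bernoulli_base l = fps_X / (degen_exp l 1 - 1)"

definition degen_euler_base :: "real \<Rightarrow> 'a::real_field fps" where
  "degen_euler_base l = 2 / (degen_exp l 1 + 1)"

lemma degen_bernoulli_base_mult:
  "degen_bernoulli_base l * (degen_exp l 1 - 1) = (fps_X :: 'a::real_field fps)"
proof -
  define g :: "'a fps" where "g = degen_exp l 1 - 1"
  have g: "fps_nth g 0 = 0" "fps_nth g 1 = 1"
    by (simp_all add: g_def degen_exp_def degen_falling_def)
  hence "subdegree g = 1" by (intro subdegreeI) auto
  moreover have "g \<noteq> 0" using g by auto
  ultimately have "g dvd fps_X" by (simp add: fps_dvd_iff)
  thus ?thesis by (simp add: degen_bernoulli_base_def g_def)
qed

lemma degen_bernoulli_base_nth_0:
  "fps_nth (degen_bernoulli_base l :: 'a::real_field fps) 0 = 1"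
  using arg_cong[OF degen_bernoulli_base_mult[of l, where 'a = 'a], of "\<lambda>f. fps_nth f 1"]
  by (simp add: fps_mult_nth degen_exp_def degen_falling_def)

lemma degen_euler_base_mult:
  "degen_euler_base l * (degen_exp l 1 + 1) = (2 :: 'a::real_field fps)"
proof -
  define g :: "'a fps" where "g = degen_exp l 1 + 1"
  have "fps_nth g 0 = 2" by (simp add: g_def degen_exp_def degen_falling_def)
  hence "is_unit g" by simp
  thus ?thesis by (simp add: degen_euler_base_def g_def unit_imp_dvd)
qed

lemma degen_euler_base_nth_0:
  "fps_nth (degen_euler_base l :: 'a::real_field fps) 0 = 1"
  using arg_cong[OF degen_euler_base_mult[of l, where 'a = 'a], of "\<lambda>f. fps_nth f 0"]
  by (simp add: degen_exp_def degen_falling_def fps_numeral_nth_0)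

definition degen_bernoulli_order :: "real \<Rightarrow> real \<Rightarrow> nat \<Rightarrow> 'a::real_field \<Rightarrow> 'a" where
  "degen_bernoulli_order l a n x =
     fact n * fps_nth (fps_rpow (degen_bernoulli_base l) a * degen_exp l x) n"

definition degen_euler_order :: "real \<Rightarrow> real \<Rightarrow> nat \<Rightarrow> 'a::real_field \<Rightarrow> 'a" where
  "degen_euler_order l a n x =
     fact n * fps_nth (fps_rpow (degen_euler_base l) a * degen_exp l x) n"

definition degen_bernoulli :: "real \<Rightarrow> nat \<Rightarrow> 'a::real_field \<Rightarrow> 'a" where
  "degen_bernoulli l = degen_bernoulli_order l 1"

definition degen_euler :: "real \<Rightarrow> nat \<Rightarrow> 'a::real_field \<Rightarrow> 'a" where
  "degen_euler l = degen_euler_order l 1"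

end

(* With B = t / (e(t) - 1) and E = 2 / (e(t) + 1), where e = degen_exp l 1, the relations
   t B^(a-1) = B^a (e - 1) and E^(b-1) = E^b (e + 1) / 2 give
   (B^a + t/2 B^(a-1)) E = B^a and (2/t) (E^(b-1) - E^b) B = E^b.
   Multiplying by the degenerate exponentials of x and y and comparing coefficients
   yields both identities. *)
theory Submission
  imports Defs
begin

text \<open>Taking \<open>l\<close> out of every factor of the falling product leaves a generalized
  binomial coefficient of \<open>x / l\<close>. This identifies \<open>degen_exp l x\<close> as the
  formal (1 + l t)^(x/l), so that it inherits the exponent law of the binomial series.\<close>

lemma degen_exp_conv_fps_binomial:
  fixes x :: "'a::real_field"
  assumes "l \<noteq> 0"
  shows "degen_exp l x = fps_binomial (x / of_real l) oo (fps_const (of_real l) * fps_X)"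
proof (rule fps_ext)
  fix n
  have "(\<Prod>i<n. x - of_nat i * of_real l) = (\<Prod>i<n. of_real l * (x / of_real l - of_nat i))"
    using assms by (intro prod.cong) (simp_all add: field_simps)
  also have "\<dots> = of_real l ^ n * (\<Prod>i<n. x / of_real l - of_nat i)"
    by (simp add: prod.distrib)
  finally show "fps_nth (degen_exp l x) n =
      fps_nth (fps_binomial (x / of_real l) oo (fps_const (of_real l) * fps_X)) n"
    by (simp add: degen_exp_def degen_falling_def fps_compose_linear gbinomial_prod_rev
        atLeast0LessThan)
qed

lemma degen_exp_add:
  fixes x y :: "'a::real_field"
  assumes "l \<noteq> 0"
  shows "degen_exp l (x + y) = degen_exp l x * degen_exp l y"
  using assms
  by (simp add: degen_exp_conv_fps_binomial add_divide_distrib fps_binomial_add_mult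
      fps_compose_mult_distrib)

text \<open>Products of exponential generating functions correspond to binomial convolutions, since
  n! = (n choose k) k! (n-k)!. Both final sums arise from this rule.\<close>

lemma fact_times_fps_mult_nth:
  fixes F G :: "'a::field_char_0 fps"
  shows "fact n * fps_nth (F * G) n =
    (\<Sum>k=0..n. of_nat (n choose k) * (fact k * fps_nth F k) * (fact (n - k) * fps_nth G (n - k)))"
  unfolding fps_mult_nth sum_distrib_left
  by (intro sum.cong refl) (simp add: binomial_fact)

lemma fps_rpow_1: "fps_nth F 0 = 1 \<Longrightarrow> fps_rpow F 1 = F"
  using fps_rpow_of_nat[of F 1] by simp

text \<open>Splitting off one factor lets the relations B (e - 1) = t and E (e + 1) = 2 act on
  powers of arbitrary real order.\<close>

lemma fps_rpow_diff_1:
  assumes "fps_nth F 0 = 1"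
  shows "fps_rpow F a = fps_rpow F (a - 1) * F"
  using fps_rpow_add[OF assms, of "a - 1" 1] fps_rpow_1[OF assms] by simp

text \<open>Only the term j = 0 of the binomial series reaches the constant coefficient. It follows
  that two powers of one series differ by a multiple of t, which permits the division by t in
  \<open>degen_euler_order_add\<close>.\<close>

lemma fps_rpow_nth_0: "fps_nth (fps_rpow F a) 0 = 1"
  by (simp add: fps_rpow_def)

lemma degen_bernoulli_rpow_diff_1:
  "fps_X * fps_rpow (degen_bernoulli_base l) (a - 1) =
     fps_rpow (degen_bernoulli_base l) a * (degen_exp l 1 - (1 :: 'a::real_field fps))"
  by (simp add: fps_rpow_diff_1[OF degen_bernoulli_base_nth_0, of l a] mult.assoc
      degen_bernoulli_base_mult mult.commute[of fps_X])

lemma degen_euler_rpow_diff_1: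
  "2 * fps_rpow (degen_euler_base l) (b - 1) =
     fps_rpow (degen_euler_base l) b * (degen_exp l 1 + (1 :: 'a::real_field fps))"
  by (simp add: fps_rpow_diff_1[OF degen_euler_base_nth_0, of l b] mult.assoc
      degen_euler_base_mult mult.commute[of 2])

lemma degen_bernoulli_order_add:
  fixes x y :: "'a::real_field"
  assumes "l \<noteq> 0"
  shows "degen_bernoulli_order l a n (x + y) =
           (\<Sum>k=0..n. of_nat (n choose k) *
              (degen_bernoulli_order l a k x
                + (if k = 0 then 0
                   else of_nat k / 2 * degen_bernoulli_order l (a - 1) (k - 1) x)) *
              degen_euler l (n - k) y)"
proof -
  define P where "P = fps_rpow (degen_bernoulli_base l :: 'a fps) a"
  define Q where "Q = fps_rpow (degen_bernoulli_base l :: 'a fps) (a - 1)"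
  define e where "e = degen_exp l (1 :: 'a)"
  define E where "E = (degen_euler_base l :: 'a fps)"
  \<comment> \<open>\<open>F\<close> is the exponential generating function of the square bracket in
    the claim.\<close>
  define F where "F = P * degen_exp l x + fps_const (1/2) * (fps_X * (Q * degen_exp l x))"
  have XQ: "fps_X * Q = P * (e - 1)"
    unfolding P_def Q_def e_def by (rule degen_bernoulli_rpow_diff_1)
  have E: "E * (e + 1) = 2"
    unfolding E_def e_def by (rule degen_euler_base_mult)
  \<comment> \<open>The bracket is doubled to clear the half: 2 P + P (e - 1) = P (e + 1), and
    \<open>E\<close> turns e + 1 into 2. The factor 2 is cancelled at the end.\<close>
  have "2 * fps_const (1/2) = (1 :: 'a fps)"
    by (simp add: numeral_fps_const)
  hence "2 * (P + fps_const (1/2) * (fps_X * Q)) = 2 * P + fps_X * Q"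
    by (simp only: distrib_left mult.assoc[symmetric] mult_1)
  also have "\<dots> = P * (e + 1)"
    by (simp add: XQ algebra_simps)
  finally have "2 * (P + fps_const (1/2) * (fps_X * Q)) * E = P * (E * (e + 1))"
    by (simp only: mult_ac)
  hence "2 * ((P + fps_const (1/2) * (fps_X * Q)) * E) = 2 * P"
    by (simp only: E mult.assoc mult.commute[of P])
  hence PE: "(P + fps_const (1/2) * (fps_X * Q)) * E = P"
    by simp
  have "F * (E * degen_exp l y) =
      ((P + fps_const (1/2) * (fps_X * Q)) * E) * (degen_exp l x * degen_exp l y)"
    by (simp add: F_def algebra_simps)
  hence *: "P * degen_exp l (x + y) = F * (E * degen_exp l y)"
    by (simp only: PE degen_exp_add[OF assms])
  \<comment> \<open>The factor t lowers the index by one, and k! = k (k-1)! supplies the coefficient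
    k; at k = 0 the shifted term vanishes.\<close>
  have F: "fact k * fps_nth F k = degen_bernoulli_order l a k x
      + (if k = 0 then 0 else of_nat k / 2 * degen_bernoulli_order l (a - 1) (k - 1) x)" for k
    by (cases k) (simp_all add: F_def degen_bernoulli_order_def P_def Q_def add_divide_distrib
        distrib_left distrib_right)
  have G: "fact k * fps_nth (E * degen_exp l y) k = degen_euler l k y" for k
    by (simp add: degen_euler_def degen_euler_order_def E_def
        fps_rpow_1[OF degen_euler_base_nth_0])
  have "degen_bernoulli_order l a n (x + y) = fact n * fps_nth (P * degen_exp l (x + y)) n"
    by (simp add: degen_bernoulli_order_def P_def)
  also have "\<dots> = (\<Sum>k=0..n. of_nat (n choose k) * (fact k * fps_nth F k) *
      (fact (n - k) * fps_nth (E * degen_exp l y) (n - k)))"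
    unfolding * by (rule fact_times_fps_mult_nth)
  finally show ?thesis
    unfolding F G .
qed

lemma degen_euler_order_add:
  fixes x y :: "'a::real_field"
  assumes "l \<noteq> 0"
  shows "degen_euler_order l b n (x + y) =
           (\<Sum>k=0..n. of_nat (n choose k) * (2 / of_nat (k + 1)) *
              degen_bernoulli l (n - k) x *
              (degen_euler_order l (b - 1) (k + 1) y - degen_euler_order l b (k + 1) y))"
proof -
  define P where "P = fps_rpow (degen_euler_base l :: 'a fps) b"
  define Q where "Q = fps_rpow (degen_euler_base l :: 'a fps) (b - 1)"
  define e where "e = degen_exp l (1 :: 'a)"
  define B where "B = (degen_bernoulli_base l :: 'a fps)"
  define C where "C = 2 * ((Q - P) * degen_exp l y)"
  \<comment> \<open>This is the exact quotient C / t, because \<open>P\<close> and \<open>Q\<close>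
    both have constant term 1. The shift is the source of the index k + 1.\<close>
  define F where "F = fps_shift 1 C"
  have Q: "2 * Q = P * (e + 1)"
    unfolding P_def Q_def e_def by (rule degen_euler_rpow_diff_1)
  have B: "B * (e - 1) = fps_X"
    unfolding B_def e_def by (rule degen_bernoulli_base_mult)
  have "fps_nth C 0 = 0"
    by (simp add: C_def P_def Q_def fps_rpow_nth_0)
  hence XF: "fps_X * F = C"
    by (intro fps_ext) (simp add: F_def)
  have C: "C = P * (e - 1) * degen_exp l y"
  proof -
    have "C = (2 * Q - 2 * P) * degen_exp l y"
      by (simp add: C_def algebra_simps)
    thus ?thesis by (simp only: Q) (simp add: algebra_simps)
  qed
  \<comment> \<open>Multiplying by t restores \<open>C\<close>, whose factor e - 1 is then absorbed
    by \<open>B\<close> into t; that t cancels against the one introduced here.\<close>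
  have "fps_X * (F * (B * degen_exp l x)) =
      P * (B * (e - 1)) * (degen_exp l x * degen_exp l y)"
    unfolding mult.assoc[symmetric] XF C by (simp add: mult_ac)
  also have "\<dots> = fps_X * (P * degen_exp l (x + y))"
    by (simp add: B degen_exp_add[OF assms] mult_ac)
  finally have *: "P * degen_exp l (x + y) = F * (B * degen_exp l x)"
    by simp
  have F: "fact k * fps_nth F k = 2 / of_nat (k + 1) *
      (degen_euler_order l (b - 1) (k + 1) y - degen_euler_order l b (k + 1) y)" for k
  proof -
    have C': "fps_nth C (k + 1) =
        2 * (fps_nth (Q * degen_exp l y) (k + 1) - fps_nth (P * degen_exp l y) (k + 1))"
      by (simp add: C_def left_diff_distrib numeral_fps_const)
    \<comment> \<open>The weight 2 / (k + 1) comes from k! = (k+1)! / (k+1): the shifted coefficient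
      carries k!, whereas the Euler values of index k + 1 carry (k+1)!.\<close>
    have "of_nat (k + 1) \<noteq> (0 :: 'a)"
      unfolding of_nat_eq_0_iff by simp
    hence "fact k * (2 * (u - v)) =
        2 / of_nat (k + 1) * (fact (k + 1) * u - fact (k + 1) * v)" for u v :: 'a
      by (simp add: field_simps del: of_nat_Suc of_nat_add)
    thus ?thesis
      by (simp only: F_def fps_shift_nth C' degen_euler_order_def P_def Q_def)
  qed
  have G: "fact k * fps_nth (B * degen_exp l x) k = degen_bernoulli l k x" for k
    by (simp add: degen_bernoulli_def degen_bernoulli_order_def B_def
        fps_rpow_1[OF degen_bernoulli_base_nth_0])
  have "degen_euler_order l b n (x + y) = fact n * fps_nth (P * degen_exp l (x + y)) n"
    by (simp add: degen_euler_order_def P_def)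
  also have "\<dots> = (\<Sum>k=0..n. of_nat (n choose k) * (fact k * fps_nth F k) *
      (fact (n - k) * fps_nth (B * degen_exp l x) (n - k)))"
    unfolding * by (rule fact_times_fps_mult_nth)
  finally show ?thesis
    unfolding F G by (simp only: mult_ac)
qed

theorem theorem3p11:
  fixes l a b :: real and x y :: "'a::real_field" and n :: nat
  assumes "l \<noteq> 0"
  shows "degen_bernoulli_order l a n (x + y) =
           (\<Sum>k=0..n. of_nat (n choose k) *
              (degen_bernoulli_order l a k x
                + (if k = 0 then 0
                   else of_nat k / 2 * degen_bernoulli_order l (a - 1) (k - 1) x)) *
              degen_euler l (n - k) y)
       \<and> degen_euler_order l b n (x + y) =
           (\<Sum>k=0..n. of_nat (n choose k) * (2 / of_nat (k + 1)) *
              degen_bernoulli l (n - k) x *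
              (degen_euler_order l (b - 1) (k + 1) y - degen_euler_order l b (k + 1) y))"
  using assms by (intro conjI degen_bernoulli_order_add degen_euler_order_add)

end
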